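(* Let $1/2<\mu\le 1$. The function $h_\mu$ is strictly increasing on $[0,1]$.
   Context: For $1/2<\mu\le 1$, $h_\mu:[0,1]\to[0,1]$ denotes the unique function from $[0,1]$ to $[0,1]$ satisfying the functional equation $h_\mu(x)=\tfrac12 h_\mu(2\mu x)$ for $0\le x\le 1/2$ and $h_\mu(x)=1-\tfrac12 h_\mu(2\mu(1-x))$ for $1/2<x\le 1$. (Existence and uniqueness follow from the contraction mapping theorem: $h_\mu$ is the fixed point of the operator $M_\mu f(x)=\tfrac12 f(2\mu x)$ for $0\le x\le 1/2$, $M_\mu f(x)=1-\tfrac12 f(2\mu(1-x))$ for $1/2<x\le1$, on the set of all functions $f:[0,1]\to[0,1]$ with the sup norm.) *)

theory Defs
  imports Complex_Main "HOL-Library.FuncSet"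
begin

text \<open>
  A function from \<open>[0,1]\<close> to \<open>[0,1]\<close> is represented by an element of
  \<open>{0..1} \<rightarrow>\<^sub>E {0..1}\<close>, i.e. a total function on the reals that is \<open>undefined\<close>
  off \<open>[0,1]\<close>; equality of such functions is equality on \<open>[0,1]\<close>. For
  \<open>1/2 < \<mu> \<le> 1\<close> the arguments \<open>2\<mu>x\<close> (\<open>x \<le> 1/2\<close>) and \<open>2\<mu>(1-x)\<close> (\<open>x > 1/2\<close>)
  stay inside \<open>[0,1]\<close>.
\<close>

definition h_equation :: "real \<Rightarrow> (real \<Rightarrow> real) \<Rightarrow> bool" where
  "h_equation \<mu> h \<longleftrightarrow>
     (\<forall>x. 0 \<le> x \<and> x \<le> 1/2 \<longrightarrow> h x = 1/2 * h (2 * \<mu> * x)) \<and>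
     (\<forall>x. 1/2 < x \<and> x \<le> 1 \<longrightarrow> h x = 1 - 1/2 * h (2 * \<mu> * (1 - x)))"

definition h_mu :: "real \<Rightarrow> real \<Rightarrow> real" where
  "h_mu \<mu> = (THE f. f \<in> {0..1} \<rightarrow>\<^sub>E {0..1} \<and> h_equation \<mu> f)"

text \<open>The description above is proper: the functional equation has exactly one solution.\<close>

definition M_op :: "real \<Rightarrow> (real \<Rightarrow> real) \<Rightarrow> real \<Rightarrow> real" where
  "M_op \<mu> f x = (if x \<le> 1/2 then 1/2 * f (2 * \<mu> * x) else 1 - 1/2 * f (2 * \<mu> * (1 - x)))"

lemma h_equation_iff_M_op: "h_equation \<mu> f \<longleftrightarrow> (\<forall>x\<in>{0..1}. f x = M_op \<mu> f x)"
  unfolding h_equation_def M_op_def by (auto simp: not_le)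

lemma tent_arg:
  fixes \<mu> x :: real
  assumes "1/2 < \<mu>" "\<mu> \<le> 1" "x \<in> {0..1}"
  shows "x \<le> 1/2 \<Longrightarrow> 2 * \<mu> * x \<in> {0..1}"
    and "\<not> x \<le> 1/2 \<Longrightarrow> 2 * \<mu> * (1 - x) \<in> {0..1}"
proof -
  have *: "2 * \<mu> * y \<in> {0..1}" if "0 \<le> y" "y \<le> 1/2" for y
    using mult_mono[of \<mu> 1 y "1/2"] assms that by auto
  show "x \<le> 1/2 \<Longrightarrow> 2 * \<mu> * x \<in> {0..1}" using *[of x] assms by auto
  show "\<not> x \<le> 1/2 \<Longrightarrow> 2 * \<mu> * (1 - x) \<in> {0..1}" using *[of "1 - x"] assms by auto
qed

lemma M_op_range:
  assumes "1/2 < \<mu>" "\<mu> \<le> 1" "\<And>x. x \<in> {0..1} \<Longrightarrow> f x \<in> {0..1}" "x \<in> {0..1}"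
  shows "M_op \<mu> f x \<in> {0..1}"
  using assms(3)[OF tent_arg(1)[OF assms(1,2,4)]] assms(3)[OF tent_arg(2)[OF assms(1,2,4)]]
  unfolding M_op_def by auto

lemma M_op_contraction:
  assumes "1/2 < \<mu>" "\<mu> \<le> 1" "\<And>x. x \<in> {0..1} \<Longrightarrow> \<bar>f x - g x\<bar> \<le> c" "x \<in> {0..1}"
  shows "\<bar>M_op \<mu> f x - M_op \<mu> g x\<bar> \<le> c / 2"
proof (cases "x \<le> 1/2")
  case True
  then show ?thesis
    using assms(3)[OF tent_arg(1)[OF assms(1,2,4) True]] unfolding M_op_def if_P[OF True] by linarith
next
  case False
  then show ?thesis
    using assms(3)[OF tent_arg(2)[OF assms(1,2,4) False]] unfolding M_op_def if_not_P[OF False] by linarith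
qed

lemma h_mu_ex1:
  assumes \<mu>: "1/2 < \<mu>" "\<mu> \<le> 1"
  shows "\<exists>!f. f \<in> {0..1} \<rightarrow>\<^sub>E {0..1} \<and> h_equation \<mu> f"
proof -
  define F where "F n = (M_op \<mu> ^^ n) (\<lambda>_. 0)" for n
  have F_Suc: "F (Suc n) = M_op \<mu> (F n)" for n by (simp add: F_def)
  have F_range: "F n x \<in> {0..1}" if "x \<in> {0..1}" for n x
    using that
  proof (induction n arbitrary: x)
    case 0 then show ?case by (simp add: F_def)
  next
    case (Suc n) then show ?case unfolding F_Suc by (intro M_op_range[OF \<mu>])
  qed
  have F_close: "\<bar>F (n + m) x - F n x\<bar> \<le> (1/2) ^ n" if "x \<in> {0..1}" for n m x
    using that
  proof (induction n arbitrary: x)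
    case 0 then show ?case using F_range[of x m] by (simp add: F_def)
  next
    case (Suc n)
    then show ?case using M_op_contraction[OF \<mu> Suc.IH] by (simp add: F_Suc)
  qed
  have conv: "convergent (\<lambda>n. F n x)" if x: "x \<in> {0..1}" for x
  proof -
    have "Cauchy (\<lambda>n. F n x)"
    proof (rule CauchyI')
      fix e :: real assume "e > 0"
      then obtain N where N: "(1/2) ^ N < e" using real_arch_pow_inv[of e "1/2"] by auto
      have "dist (F m x) (F n x) < e" if "m \<ge> N" "n > m" for m n
      proof -
        have "\<bar>F n x - F m x\<bar> \<le> (1/2) ^ m" using F_close[OF x, of m "n - m"] that by simp
        also have "\<dots> \<le> (1/2) ^ N" using that by (intro power_decreasing) auto
        finally show ?thesis using N by (simp add: dist_real_def abs_minus_commute)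
      qed
      then show "\<exists>N. \<forall>m\<ge>N. \<forall>n>m. dist (F m x) (F n x) < e" by blast
    qed
    then show ?thesis by (simp add: Cauchy_convergent_iff)
  qed
  define g where "g = restrict (\<lambda>x. lim (\<lambda>n. F n x)) {0..1}"
  have lim: "(\<lambda>n. F n x) \<longlonglongrightarrow> g x" if "x \<in> {0..1}" for x
    using conv[OF that] that by (simp add: g_def convergent_LIMSEQ_iff)
  have g_range: "g x \<in> {0..1}" if "x \<in> {0..1}" for x
    using closed_sequentially[OF closed_atLeastAtMost _ lim[OF that]] F_range[OF that] by auto
  have g_fix: "g x = M_op \<mu> g x" if x: "x \<in> {0..1}" for x
  proof -
    have "(\<lambda>n. M_op \<mu> (F n) x) \<longlonglongrightarrow> M_op \<mu> g x"
      unfolding M_op_def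
      using lim[OF tent_arg(1)[OF \<mu> x]] lim[OF tent_arg(2)[OF \<mu> x]]
      by (auto intro!: tendsto_intros)
    moreover have "(\<lambda>n. M_op \<mu> (F n) x) \<longlonglongrightarrow> g x"
      using LIMSEQ_Suc[OF lim[OF x]] by (simp add: F_Suc)
    ultimately show ?thesis using LIMSEQ_unique by blast
  qed
  show ?thesis
  proof (rule ex1I[of _ g])
    show "g \<in> {0..1} \<rightarrow>\<^sub>E {0..1} \<and> h_equation \<mu> g"
      using g_range g_fix unfolding h_equation_iff_M_op by (auto simp: g_def)
  next
    fix f assume f: "f \<in> {0..1} \<rightarrow>\<^sub>E {0..1} \<and> h_equation \<mu> f"
    have close: "\<bar>f x - g x\<bar> \<le> (1/2) ^ n" if "x \<in> {0..1}" for n x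
      using that
    proof (induction n arbitrary: x)
      case 0
      then have "f x \<in> {0..1}" using f by blast
      then show ?case using g_range[OF 0] by auto
    next
      case (Suc n)
      have "f x = M_op \<mu> f x" using f Suc.prems by (simp add: h_equation_iff_M_op)
      then show ?case
        using M_op_contraction[OF \<mu> Suc.IH Suc.prems] g_fix[OF Suc.prems] by simp
    qed
    show "f = g"
    proof (rule extensionalityI[of _ "{0..1}"])
      show "f \<in> extensional {0..1}" using f by (simp add: PiE_def)
      show "g \<in> extensional {0..1}" by (simp add: g_def)
      fix x :: real assume x: "x \<in> {0..1}"
      have "(\<lambda>n. (1/2::real) ^ n) \<longlonglongrightarrow> 0" by (intro LIMSEQ_power_zero) simp
      then have "\<bar>f x - g x\<bar> \<le> 0" by (rule LIMSEQ_le_const) (use close[OF x] in auto)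
      then show "f x = g x" by simp
    qed
  qed
qed

lemma
  assumes "1/2 < \<mu>" "\<mu> \<le> 1"
  shows h_mu_in: "h_mu \<mu> \<in> {0..1} \<rightarrow>\<^sub>E {0..1}"
    and h_mu_satisfies: "h_equation \<mu> (h_mu \<mu>)"
  using theI'[OF h_mu_ex1[OF assms]] unfolding h_mu_def by auto

end

theory Submission
  imports Defs
begin

text \<open>
  The value \<open>h x\<close> encodes the itinerary of \<open>x\<close> under the tent map of slope \<open>2\<mu> > 1\<close>.
  Points on the same side of \<open>1/2\<close> are driven apart by the factor \<open>2\<mu>\<close>, and the functional
  equation pulls back a strict inequality between the values at their images; hence it suffices to
  treat \<open>x \<le> 1/2 < y\<close>, where \<open>h x \<le> 1/2 \<le> h y\<close>. Equality would force the value \<open>1\<close> at both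
  tent images, but expansion shows that \<open>h\<close> vanishes only at \<open>0\<close> and so equals \<open>1\<close> only at \<open>1\<close>,
  while \<open>2\<mu>(1 - y) < 1\<close>.
\<close>

locale tent_conjugacy =
  fixes \<mu> :: real and h :: "real \<Rightarrow> real"
  assumes \<mu>: "1/2 < \<mu>" "\<mu> \<le> 1"
    and range: "x \<in> {0..1} \<Longrightarrow> h x \<in> {0..1}"
    and equation: "h_equation \<mu> h"
begin

lemma left: "0 \<le> x \<Longrightarrow> x \<le> 1/2 \<Longrightarrow> h x = h (2 * \<mu> * x) / 2"
  and right: "1/2 < x \<Longrightarrow> x \<le> 1 \<Longrightarrow> h x = 1 - h (2 * \<mu> * (1 - x)) / 2"
  using equation by (auto simp: h_equation_def)

lemma left_le_half:
  assumes "0 \<le> x" "x \<le> 1/2"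
  shows "h x \<le> 1/2"
  using left[OF assms] range[OF tent_arg(1)[OF \<mu>, of x]] assms by auto

lemma right_ge_half:
  assumes "1/2 < x" "x \<le> 1"
  shows "1/2 \<le> h x"
  using right[OF assms] range[OF tent_arg(2)[OF \<mu>, of x]] assms by auto

text \<open>A zero lies in the left half, where the tent map multiplies by \<open>2 * \<mu>\<close>,
  and its image is again a zero. The orbit of a positive zero would thus grow geometrically inside
  the unit interval.\<close>

lemma zero_imp_zero:
  assumes "x \<in> {0..1}" "h x = 0"
  shows "x = 0"
proof (rule ccontr)
  assume "x \<noteq> 0"
  then have "x > 0" using assms by auto
  have orbit: "(2 * \<mu>) ^ n * x \<in> {0..1} \<and> h ((2 * \<mu>) ^ n * x) = 0" for n
  proof (induction n)
    case 0
    then show ?case using assms by simp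
  next
    case (Suc n)
    let ?y = "(2 * \<mu>) ^ n * x"
    have "?y \<le> 1/2" using right_ge_half[of ?y] Suc by fastforce
    then show ?case
      using Suc left[of ?y] tent_arg(1)[OF \<mu>, of ?y] by (simp add: mult.assoc)
  qed
  obtain n where "1 / x < (2 * \<mu>) ^ n" using real_arch_pow[of "2 * \<mu>" "1 / x"] \<mu> by auto
  then show False using orbit[of n] \<open>x > 0\<close> by (simp add: field_simps)
qed

lemma one_imp_one:
  assumes "x \<in> {0..1}" "h x = 1"
  shows "x = 1"
proof -
  have "\<not> x \<le> 1/2" using left_le_half[of x] assms by auto
  then have "h (2 * \<mu> * (1 - x)) = 0" "2 * \<mu> * (1 - x) \<in> {0..1}"
    using right[of x] tent_arg(2)[OF \<mu> assms(1)] assms by auto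
  then have "2 * \<mu> * (1 - x) = 0" by (rule zero_imp_zero[rotated])
  then show ?thesis using \<mu> by simp
qed

lemma across_half:
  assumes "0 \<le> x" "x \<le> 1/2" "1/2 < y" "y \<le> 1"
  shows "h x < h y"
proof (rule ccontr)
  assume "\<not> h x < h y"
  then have "h y = 1/2"
    using left_le_half[of x] right_ge_half[of y] assms by simp
  then have "h (2 * \<mu> * (1 - y)) = 1" using right[of y] assms by simp
  then have "2 * \<mu> * (1 - y) = 1"
    using one_imp_one tent_arg(2)[OF \<mu>, of y] assms by auto
  moreover have "2 * \<mu> * (1 - y) \<le> 2 * (1 - y)" using \<mu> assms by (intro mult_right_mono) auto
  ultimately show False using assms by simp
qed

text \<open>Each step on a common side of 1/2 multiplies the gap by \<open>2 * \<mu>\<close>, so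
  \<open>n\<close> bounds the number of steps before 1/2 separates the points.\<close>

lemma strict_mono_if_separated:
  assumes "1 \<le> (2 * \<mu>) ^ n * (y - x)" "0 \<le> x" "x < y" "y \<le> 1"
  shows "h x < h y"
  using assms
proof (induction n arbitrary: x y)
  case 0
  \<comment> \<open>A gap of at least 1 forces \<open>x = 0\<close> and
    \<open>y = 1\<close>.\<close>
  then show ?case by (intro across_half) auto
next
  case (Suc n)
  consider "y \<le> 1/2" | "x \<le> 1/2" "1/2 < y" | "1/2 < x" by linarith
  then show ?case
  proof cases
    case 1
    have "h (2 * \<mu> * x) < h (2 * \<mu> * y)"
      using Suc.prems 1 \<mu> tent_arg(1)[OF \<mu>, of y]
      by (intro Suc.IH) (auto simp: algebra_simps)
    then show ?thesis using left[of x] left[of y] Suc.prems 1 by simp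
  next
    case 2
    then show ?thesis using Suc.prems by (intro across_half) auto
  next
    case 3
    \<comment> \<open>The right branch reverses the order; the minus sign in the equation restores
      it.\<close>
    have "h (2 * \<mu> * (1 - y)) < h (2 * \<mu> * (1 - x))"
      using Suc.prems 3 \<mu> tent_arg(2)[OF \<mu>, of x]
      by (intro Suc.IH) (auto simp: algebra_simps)
    then show ?thesis using right[of x] right[of y] Suc.prems 3 by simp
  qed
qed

lemma strict_mono: "strict_mono_on {0..1} h"
proof (rule strict_mono_onI)
  fix x y :: real
  assume xy: "x \<in> {0..1}" "y \<in> {0..1}" "x < y"
  obtain n where "1 / (y - x) < (2 * \<mu>) ^ n"
    using real_arch_pow[of "2 * \<mu>" "1 / (y - x)"] \<mu> by auto
  then have "1 \<le> (2 * \<mu>) ^ n * (y - x)" using xy by (simp add: pos_divide_less_eq)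
  then show "h x < h y" using xy by (intro strict_mono_if_separated) auto
qed

end

theorem theorem2p17:
  fixes \<mu> :: real
  assumes "1/2 < \<mu>" and "\<mu> \<le> 1"
  shows "strict_mono_on {0..1} (h_mu \<mu>)"
proof -
  interpret tent_conjugacy \<mu> "h_mu \<mu>"
    using assms h_mu_in[OF assms] h_mu_satisfies[OF assms] by unfold_locales auto
  show ?thesis by (rule strict_mono)
qed

end
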